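(* Let $H\ge2$ be real, let $T\ge1$ be an integer, let $\tau$ be a positive divisor of $T$, and let $\vartheta\in\mathbb{R}$. Let $f$ be the generalized tent map with parameter $H$ and let $F(x)=f\left(\vartheta x+(1-\vartheta)f^{(T)}(x)\right)$. (1) Suppose $\frac{H^T-\frac1H}{H^T-1}<\vartheta<\frac{H^T+\frac1H}{H^T-1}$ (the condition under which $T$-cycles of $f$ with positive multiplier are locally asymptotically stable cycles of $F$). Then all $\tau$-cycles of $f$ whose multiplier is positive, and, if $\frac T\tau$ is even, all $\tau$-cycles of $f$ whose multiplier is negative, are locally asymptotically stable cycles of $x_{n+1}=F(x_n)$. (2) Suppose $\frac{H^T-\frac1H}{H^T+1}<\vartheta<\frac{H^T+\frac1H}{H^T+1}$ (the condition under which $T$-cycles of $f$ with negative multiplier are locally asymptotically stable cycles of $F$). Then, if $\frac T\tau$ is odd, all $\tau$-cycles of $f$ whose multiplier is negative are locally asymptotically stable cycles of $x_{n+1}=F(x_n)$.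
   Context: The generalized tent map with parameter $H\ge2$ is $f:\mathbb{R}\to\mathbb{R}$, $f(x)=H\left(\frac12-\left|x-\frac12\right|\right)$, i.e. $f(x)=Hx$ for $x\le\frac12$ and $f(x)=H(1-x)$ for $x>\frac12$. For a map $g$, $g^{(k)}$ denotes the $k$-fold iterate of $g$. A $\tau$-cycle of $g$ is a set of $\tau$ distinct points $\{\eta_1,\ldots,\eta_\tau\}$ with $\eta_{j+1}=g(\eta_j)$ for $j=1,\ldots,\tau-1$ and $\eta_1=g(\eta_\tau)$. The multiplier of a $\tau$-cycle $\{\eta_1,\ldots,\eta_\tau\}$ of $f$ is $\mu=f'(\eta_\tau)\cdots f'(\eta_1)$. For $\tau\mid T$, every $\tau$-cycle of $f$ is also a $\tau$-cycle of $F$. Local asymptotic stability of a cycle is understood in the usual sense (Lyapunov stable, and attracting all orbits starting sufficiently near it). *)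

theory Defs
  imports "HOL-Analysis.Analysis"
begin

definition tent_map :: "real \<Rightarrow> real \<Rightarrow> real" where
  "tent_map H x = H * (1/2 - \<bar>x - 1/2\<bar>)"

lemma tent_map_piecewise:
  "tent_map H x = (if x \<le> 1/2 then H * x else H * (1 - x))"
  by (auto simp: tent_map_def algebra_simps abs_if)

definition controlled_map :: "(real \<Rightarrow> real) \<Rightarrow> nat \<Rightarrow> real \<Rightarrow> real \<Rightarrow> real" where
  "controlled_map f T \<theta> x = f (\<theta> * x + (1 - \<theta>) * (f ^^ T) x)"

definition is_cycle :: "('a \<Rightarrow> 'a) \<Rightarrow> nat \<Rightarrow> 'a set \<Rightarrow> bool" where
  "is_cycle g \<tau> C \<longleftrightarrow> 0 < \<tau> \<and>
     (\<exists>\<eta> :: nat \<Rightarrow> 'a. inj_on \<eta> {1..\<tau>} \<and> C = \<eta> ` {1..\<tau>} \<and>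
        (\<forall>j\<in>{1..<\<tau>}. \<eta> (Suc j) = g (\<eta> j)) \<and> \<eta> 1 = g (\<eta> \<tau>))"

(* deriv is an arbitrary value where g is not differentiable. For the tent map with H \<ge> 2
   this does not matter: the orbit of the kink 1/2 goes to H/2 \<ge> 1 and then to a value \<le> 0,
   so it never returns to 1/2, and no cycle contains 1/2. *)
definition multiplier :: "(real \<Rightarrow> real) \<Rightarrow> real set \<Rightarrow> real" where
  "multiplier g C = (\<Prod>x\<in>C. deriv g x)"

(* The distance of a point to the cycle is the distance to the cycle as a set;
   infdist x {} = 0 plays no role here, since a cycle is nonempty. *)
definition lyapunov_stable :: "('a::metric_space \<Rightarrow> 'a) \<Rightarrow> 'a set \<Rightarrow> bool" where
  "lyapunov_stable g C \<longleftrightarrow>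
     (\<forall>\<epsilon>>0. \<exists>\<delta>>0. \<forall>x. infdist x C < \<delta> \<longrightarrow> (\<forall>n. infdist ((g ^^ n) x) C < \<epsilon>))"

definition locally_attracting :: "('a::metric_space \<Rightarrow> 'a) \<Rightarrow> 'a set \<Rightarrow> bool" where
  "locally_attracting g C \<longleftrightarrow>
     (\<exists>\<delta>>0. \<forall>x. infdist x C < \<delta> \<longrightarrow> (\<lambda>n. infdist ((g ^^ n) x) C) \<longlonglongrightarrow> 0)"

definition las_cycle :: "('a::metric_space \<Rightarrow> 'a) \<Rightarrow> nat \<Rightarrow> 'a set \<Rightarrow> bool" where
  "las_cycle g \<tau> C \<longleftrightarrow> is_cycle g \<tau> C \<and> lyapunov_stable g C \<and> locally_attracting g C"

end

theory Submission
  imports Defs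
begin

text \<open>
  Every point x of a \<open>\<tau>\<close>-cycle of f with \<open>\<tau>\<close> dividing T is fixed by the T-th iterate of f, so
  the control term \<open>\<theta> x + (1 - \<theta>) f\<^sup>T(x)\<close> evaluates to x and F agrees with f on the cycle. The
  kink 1/2 is mapped by two steps to a point \<open>\<le> 0\<close>, from which no orbit returns to 1/2; hence f
  has slope H or -H at each point of a cycle, and the chain rule gives
  \<open>F'(x) = f'(x) (\<theta> + (1 - \<theta>) \<mu>\<^bsup>T/\<tau>\<^esup>)\<close>, a number of modulus \<open>H \<bar>\<theta> + (1 - \<theta>) \<mu>\<^bsup>T/\<tau>\<^esup>\<bar>\<close>,
  where \<open>\<mu>\<close> is the multiplier of the cycle and \<open>\<mu>\<^bsup>T/\<tau>\<^esup>\<close> is \<open>H\<^sup>T\<close> or \<open>- H\<^sup>T\<close>, according to the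
  sign of \<open>\<mu>\<close> and the parity of \<open>T/\<tau>\<close>. The two intervals for \<open>\<theta>\<close> say exactly that this
  modulus is below 1 for the respective sign.

  Thus F contracts towards the cycle at \<^emph>\<open>each\<close> of its points, not merely on average around
  the cycle. The distance to the cycle therefore decreases geometrically along every orbit that
  starts nearby, which gives Lyapunov stability and attraction at once
  (\<open>stable_attracting_of_contraction\<close>, \<open>stable_attracting_of_deriv\<close>).
\<close>

section \<open>Stability from contraction at each point of an invariant set\<close>

lemma infdist_contraction_step:
  fixes g :: "'a::heine_borel \<Rightarrow> 'a"
  assumes "closed C" "C \<noteq> {}" "g ` C \<subseteq> C"
    and contr: "\<And>x y. x \<in> C \<Longrightarrow> dist y x < r \<Longrightarrow> dist (g y) (g x) \<le> q * dist y x"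
    and "infdist y C < r"
  shows "infdist (g y) C \<le> q * infdist y C"
proof -
  obtain x where x: "x \<in> C" "infdist y C = dist y x"
    using infdist_attains_inf[OF assms(1,2)] by metis
  have "infdist (g y) C \<le> dist (g y) (g x)"
    using x assms(3) by (intro infdist_le) auto
  also have "\<dots> \<le> q * dist y x"
    using contr[of x y] x assms(5) by simp
  finally show ?thesis
    using x by simp
qed

text \<open>Orbits that start within the radius r of the contraction estimate never leave it, since each
  step does not increase the distance to C; so the estimate may be iterated forever.\<close>

lemma stable_attracting_of_contraction:
  fixes g :: "'a::heine_borel \<Rightarrow> 'a"
  assumes "closed C" "C \<noteq> {}" "g ` C \<subseteq> C" "r > 0" "0 \<le> q" "q < 1"
    and contr: "\<And>x y. x \<in> C \<Longrightarrow> dist y x < r \<Longrightarrow> dist (g y) (g x) \<le> q * dist y x"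
  shows "lyapunov_stable g C" "locally_attracting g C"
proof -
  have geometric: "infdist ((g ^^ n) y) C \<le> q ^ n * infdist y C" if y: "infdist y C < r" for n y
  proof (induction n)
    case (Suc n)
    have "q ^ n * infdist y C \<le> 1 * infdist y C"
      using assms(5,6) by (intro mult_right_mono power_le_one) (auto simp: infdist_nonneg)
    then have "infdist ((g ^^ n) y) C < r"
      using Suc y by linarith
    then have "infdist (g ((g ^^ n) y)) C \<le> q * infdist ((g ^^ n) y) C"
      using infdist_contraction_step[OF assms(1-3) contr] by blast
    also have "\<dots> \<le> q * (q ^ n * infdist y C)"
      using Suc assms(5) by (intro mult_left_mono) auto
    finally show ?case
      by (simp add: mult.assoc)
  qed simp
  show "lyapunov_stable g C"
    unfolding lyapunov_stable_def
  proof (intro allI impI)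
    fix \<epsilon> :: real assume "\<epsilon> > 0"
    have "infdist ((g ^^ n) y) C < \<epsilon>" if y: "infdist y C < min r \<epsilon>" for n y
    proof -
      have "infdist ((g ^^ n) y) C \<le> q ^ n * infdist y C"
        using geometric y by simp
      also have "\<dots> \<le> 1 * infdist y C"
        using assms(5,6) by (intro mult_right_mono power_le_one) (auto simp: infdist_nonneg)
      finally show ?thesis
        using y by simp
    qed
    then show "\<exists>\<delta>>0. \<forall>y. infdist y C < \<delta> \<longrightarrow> (\<forall>n. infdist ((g ^^ n) y) C < \<epsilon>)"
      using \<open>\<epsilon> > 0\<close> \<open>r > 0\<close> by (intro exI[of _ "min r \<epsilon>"]) auto
  qed
  have "(\<lambda>n. infdist ((g ^^ n) y) C) \<longlonglongrightarrow> 0" if y: "infdist y C < r" for y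
  proof (rule tendsto_sandwich[of "\<lambda>_. 0"])
    show "(\<lambda>n. q ^ n * infdist y C) \<longlonglongrightarrow> 0"
      using tendsto_mult_right[OF LIMSEQ_realpow_zero[OF assms(5,6)], of "infdist y C"] by simp
    show "\<forall>\<^sub>F n in sequentially. infdist ((g ^^ n) y) C \<le> q ^ n * infdist y C"
      using geometric[OF y] by simp
  qed (auto simp: infdist_nonneg)
  then show "locally_attracting g C"
    unfolding locally_attracting_def using \<open>r > 0\<close> by blast
qed

lemma has_real_derivative_imp_contraction:
  fixes g :: "real \<Rightarrow> real"
  assumes "(g has_real_derivative D) (at x)" "\<bar>D\<bar> < q"
  shows "\<exists>r>0. \<forall>y. dist y x < r \<longrightarrow> dist (g y) (g x) \<le> q * dist y x"
proof -
  have "((\<lambda>y. (g y - g x) / (y - x)) \<longlongrightarrow> D) (at x)"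
    using assms(1) by (simp add: has_field_derivative_iff)
  then have "((\<lambda>y. \<bar>(g y - g x) / (y - x)\<bar>) \<longlongrightarrow> \<bar>D\<bar>) (at x)"
    by (rule tendsto_rabs)
  then have "\<forall>\<^sub>F y in at x. \<bar>(g y - g x) / (y - x)\<bar> < q"
    using assms(2) by (rule order_tendstoD(2))
  then obtain r where r: "r > 0"
    "\<And>y. y \<noteq> x \<Longrightarrow> dist y x < r \<Longrightarrow> \<bar>(g y - g x) / (y - x)\<bar> < q"
    unfolding eventually_at by blast
  have "dist (g y) (g x) \<le> q * dist y x" if "dist y x < r" for y
  proof (cases "y = x")
    case False
    then have "\<bar>g y - g x\<bar> / \<bar>y - x\<bar> < q"
      using r(2)[of y] that by (simp add: abs_divide)
    then show ?thesis
      using False by (simp add: dist_real_def divide_simps)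
  qed simp
  then show ?thesis
    using r(1) by blast
qed

text \<open>Finiteness of C is what turns the pointwise derivative bounds into one contraction radius and
  one contraction factor below 1.\<close>

lemma stable_attracting_of_deriv:
  fixes g :: "real \<Rightarrow> real"
  assumes "finite C" "C \<noteq> {}" "g ` C \<subseteq> C"
    and deriv: "\<And>x. x \<in> C \<Longrightarrow> (g has_real_derivative D x) (at x)"
    and small: "\<And>x. x \<in> C \<Longrightarrow> \<bar>D x\<bar> < 1"
  shows "lyapunov_stable g C" "locally_attracting g C"
proof -
  have "Max ((\<lambda>x. \<bar>D x\<bar>) ` C) < 1"
    using assms(1,2) small by simp
  then obtain q where q: "Max ((\<lambda>x. \<bar>D x\<bar>) ` C) < q" "q < 1"
    using dense by blast
  have D_less: "\<bar>D x\<bar> < q" if "x \<in> C" for x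
    using q(1) assms(1,2) that by simp
  then have "0 \<le> q"
    using assms(2) by (metis abs_ge_zero ex_in_conv less_eq_real_def order.strict_trans1)
  have "\<forall>x\<in>C. \<exists>r>0. \<forall>y. dist y x < r \<longrightarrow> dist (g y) (g x) \<le> q * dist y x"
    using has_real_derivative_imp_contraction[OF deriv D_less] by blast
  then obtain r where r: "\<And>x. x \<in> C \<Longrightarrow> r x > 0"
    "\<And>x y. x \<in> C \<Longrightarrow> dist y x < r x \<Longrightarrow> dist (g y) (g x) \<le> q * dist y x"
    by metis
  have "Min (r ` C) > 0"
    using assms(1,2) r(1) by simp
  moreover have "dist (g y) (g x) \<le> q * dist y x" if "x \<in> C" "dist y x < Min (r ` C)" for x y
    using r(2)[of x y] that assms(1,2) by simp
  ultimately show "lyapunov_stable g C" "locally_attracting g C"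
    using stable_attracting_of_contraction[OF finite_imp_closed[OF assms(1)] assms(2,3) _ \<open>0 \<le> q\<close> q(2)]
    by blast+
qed

section \<open>Cycles and their multipliers\<close>

lemma is_cycle_finite: "is_cycle g \<tau> C \<Longrightarrow> finite C"
  and is_cycle_nonempty: "is_cycle g \<tau> C \<Longrightarrow> C \<noteq> {}"
  and is_cycle_card: "is_cycle g \<tau> C \<Longrightarrow> card C = \<tau>"
  by (auto simp: is_cycle_def card_image)

lemma is_cycle_obtain_orbit:
  assumes "is_cycle g \<tau> C"
  obtains p where "C = (\<lambda>i. (g ^^ i) p) ` {..<\<tau>}" "inj_on (\<lambda>i. (g ^^ i) p) {..<\<tau>}" "(g ^^ \<tau>) p = p"
proof -
  obtain \<eta> where \<eta>: "0 < \<tau>" "inj_on \<eta> {1..\<tau>}" "C = \<eta> ` {1..\<tau>}"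
    "\<And>j. j \<in> {1..<\<tau>} \<Longrightarrow> \<eta> (Suc j) = g (\<eta> j)" "\<eta> 1 = g (\<eta> \<tau>)"
    using assms unfolding is_cycle_def by blast
  define p where "p = \<eta> 1"
  have orbit: "\<eta> (Suc i) = (g ^^ i) p" if "i < \<tau>" for i
    using that by (induction i) (use \<eta>(4) in \<open>auto simp: p_def\<close>)
  have shift: "{1..\<tau>} = Suc ` {..<\<tau>}"
    by (simp add: image_Suc_lessThan)
  have "(\<lambda>i. (g ^^ i) p) ` {..<\<tau>} = C"
    unfolding \<eta>(3) shift image_image using orbit by (intro image_cong) auto
  moreover have "inj_on (\<lambda>i. (g ^^ i) p) {..<\<tau>}"
  proof (rule inj_onI)
    fix i j assume "i \<in> {..<\<tau>}" "j \<in> {..<\<tau>}" "(g ^^ i) p = (g ^^ j) p"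
    then show "i = j"
      using orbit inj_onD[OF \<eta>(2), of "Suc i" "Suc j"] by simp
  qed
  moreover have "(g ^^ \<tau>) p = p"
    using \<eta>(1,5) orbit[of "\<tau> - 1"] by (cases \<tau>) (auto simp: p_def)
  ultimately show thesis
    using that by metis
qed

lemma is_cycle_periodic:
  assumes "is_cycle g \<tau> C" "x \<in> C"
  shows "(g ^^ \<tau>) x = x"
proof -
  obtain p where p: "C = (\<lambda>i. (g ^^ i) p) ` {..<\<tau>}" "(g ^^ \<tau>) p = p"
    using is_cycle_obtain_orbit[OF assms(1)] by metis
  then obtain i where "x = (g ^^ i) p"
    using assms(2) by auto
  then show ?thesis
    using p(2) by (metis add.commute comp_apply funpow_add)
qed

lemma is_cycle_image_subset:
  assumes "is_cycle g \<tau> C"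
  shows "g ` C \<subseteq> C"
proof
  fix y assume "y \<in> g ` C"
  obtain p where p: "C = (\<lambda>i. (g ^^ i) p) ` {..<\<tau>}" "(g ^^ \<tau>) p = p"
    using is_cycle_obtain_orbit[OF assms] by metis
  obtain i where i: "i < \<tau>" "y = (g ^^ Suc i) p"
    using \<open>y \<in> g ` C\<close> p(1) by auto
  show "y \<in> C"
  proof (cases "Suc i = \<tau>")
    case True
    then have "y = (g ^^ 0) p"
      using i p(2) by simp
    moreover have "0 \<in> {..<\<tau>}"
      using i(1) by simp
    ultimately show ?thesis
      unfolding p(1) by (rule image_eqI)
  next
    case False
    then have "Suc i \<in> {..<\<tau>}"
      using i(1) by simp
    with i(2) show ?thesis
      unfolding p(1) by (rule image_eqI)
  qed
qed

lemma is_cycle_funpow_mem: "is_cycle g \<tau> C \<Longrightarrow> x \<in> C \<Longrightarrow> (g ^^ i) x \<in> C"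
  by (induction i) (simp_all add: image_subset_iff[THEN iffD1, OF is_cycle_image_subset])

lemma is_cycle_cong:
  assumes "is_cycle g \<tau> C" "\<And>x. x \<in> C \<Longrightarrow> h x = g x"
  shows "is_cycle h \<tau> C"
proof -
  obtain \<eta> where \<eta>: "0 < \<tau>" "inj_on \<eta> {1..\<tau>}" "C = \<eta> ` {1..\<tau>}"
    "\<And>j. j \<in> {1..<\<tau>} \<Longrightarrow> \<eta> (Suc j) = g (\<eta> j)" "\<eta> 1 = g (\<eta> \<tau>)"
    using assms(1) unfolding is_cycle_def by blast
  have "\<eta> j \<in> C" if "j \<in> {1..\<tau>}" for j
    using that \<eta>(3) by blast
  then have "\<forall>j\<in>{1..<\<tau>}. \<eta> (Suc j) = h (\<eta> j)" "\<eta> 1 = h (\<eta> \<tau>)"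
    using \<eta>(1,4,5) assms(2) by auto
  then show ?thesis
    unfolding is_cycle_def using \<eta>(1-3) by blast
qed

lemma funpow_mult_periodic: "(g ^^ n) x = x \<Longrightarrow> (g ^^ (n * k)) x = x"
  by (induction k) (simp_all add: funpow_add)

text \<open>Moving the starting point one step along a periodic orbit drops the factor at x and gains the
  factor at the n-th iterate, which is the same factor.\<close>

lemma prod_periodic_orbit_shift:
  fixes h :: "'a \<Rightarrow> 'b::comm_monoid_mult"
  assumes "(g ^^ n) x = x"
  shows "(\<Prod>i<n. h ((g ^^ i) (g x))) = (\<Prod>i<n. h ((g ^^ i) x))"
proof (cases n)
  case (Suc m)
  have "(\<Prod>i<n. h ((g ^^ i) (g x))) = (\<Prod>i<m. h ((g ^^ Suc i) x)) * h ((g ^^ n) x)"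
    by (simp add: Suc funpow_swap1)
  also have "\<dots> = (\<Prod>i<n. h ((g ^^ i) x))"
    using assms unfolding Suc prod.lessThan_Suc_shift by (simp add: mult.commute)
  finally show ?thesis .
qed simp

lemma prod_periodic_orbit_start:
  fixes h :: "'a \<Rightarrow> 'b::comm_monoid_mult"
  assumes "(g ^^ n) x = x"
  shows "(\<Prod>i<n. h ((g ^^ i) ((g ^^ j) x))) = (\<Prod>i<n. h ((g ^^ i) x))"
proof (induction j)
  case (Suc j)
  have "(g ^^ n) ((g ^^ j) x) = (g ^^ j) x"
    using assms by (metis add.commute comp_apply funpow_add)
  from prod_periodic_orbit_shift[OF this, of h] show ?case
    using Suc by simp
qed simp

lemma prod_periodic_orbit_mult:
  fixes h :: "'a \<Rightarrow> 'b::comm_monoid_mult"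
  assumes "(g ^^ n) x = x"
  shows "(\<Prod>i<n * k. h ((g ^^ i) x)) = (\<Prod>i<n. h ((g ^^ i) x)) ^ k"
proof (induction k)
  case (Suc k)
  have "(\<Prod>i<n * Suc k. h ((g ^^ i) x)) =
      (\<Prod>i<n * k. h ((g ^^ i) x)) * (\<Prod>i<n. h ((g ^^ (n * k + i)) x))"
    using prod.atLeastLessThan_concat[of 0 "n * k" "n * k + n" "\<lambda>i. h ((g ^^ i) x)"]
      prod.shift_bounds_nat_ivl[of "\<lambda>i. h ((g ^^ i) x)" 0 "n * k" n]
    by (simp add: atLeast0LessThan add.commute)
  also have "(\<Prod>i<n. h ((g ^^ (n * k + i)) x)) = (\<Prod>i<n. h ((g ^^ i) x))"
    using funpow_mult_periodic[OF assms] by (simp add: add.commute[of "n * k"] funpow_add)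
  finally show ?case
    using Suc by (simp add: mult.commute)
qed simp

lemma multiplier_eq_prod_orbit:
  assumes "is_cycle g \<tau> C" "x \<in> C"
  shows "multiplier g C = (\<Prod>i<\<tau>. deriv g ((g ^^ i) x))"
proof -
  obtain p where p: "C = (\<lambda>i. (g ^^ i) p) ` {..<\<tau>}" "inj_on (\<lambda>i. (g ^^ i) p) {..<\<tau>}" "(g ^^ \<tau>) p = p"
    using is_cycle_obtain_orbit[OF assms(1)] by metis
  obtain j where j: "x = (g ^^ j) p"
    using assms(2) p(1) by auto
  have "multiplier g C = (\<Prod>i<\<tau>. deriv g ((g ^^ i) p))"
    unfolding multiplier_def p(1) using p(2) by (simp add: prod.reindex)
  then show ?thesis
    unfolding j using prod_periodic_orbit_start[OF p(3), of "deriv g" j] by simp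
qed

lemma DERIV_funpow:
  fixes g :: "real \<Rightarrow> real"
  assumes "\<And>i. i < n \<Longrightarrow> g differentiable at ((g ^^ i) x)"
  shows "(g ^^ n has_real_derivative (\<Prod>i<n. deriv g ((g ^^ i) x))) (at x)"
  using assms
proof (induction n)
  case 0
  show ?case
    by (simp add: id_def)
next
  case (Suc n)
  have "(g has_real_derivative deriv g ((g ^^ n) x)) (at ((g ^^ n) x))"
    using Suc.prems by (simp add: DERIV_deriv_iff_real_differentiable)
  from DERIV_chain[OF this Suc.IH] show ?case
    using Suc.prems by (simp add: comp_def mult.commute)
qed

section \<open>Cycles of the tent map\<close>

lemma DERIV_tent_map:
  assumes "x \<noteq> 1/2"
  shows "(tent_map H has_real_derivative (if x < 1/2 then H else - H)) (at x)"
proof (cases "x < 1/2")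
  case True
  have "((\<lambda>y. H * y) has_real_derivative H) (at x)"
    by (auto intro!: derivative_eq_intros)
  then have "(tent_map H has_real_derivative H) (at x)"
    by (rule has_field_derivative_transform_within_open[of _ _ _ "{..<1/2}"])
      (use True in \<open>auto simp: tent_map_piecewise\<close>)
  then show ?thesis
    using True by simp
next
  case False
  have "((\<lambda>y. H * (1 - y)) has_real_derivative - H) (at x)"
    by (auto intro!: derivative_eq_intros)
  then have "(tent_map H has_real_derivative - H) (at x)"
    by (rule has_field_derivative_transform_within_open[of _ _ _ "{1/2<..}"])
      (use False assms in \<open>auto simp: tent_map_piecewise\<close>)
  then show ?thesis
    using False by simp
qed

lemma tent_map_funpow_nonpos:
  assumes "H \<ge> 0" "x \<le> 0"
  shows "(tent_map H ^^ n) x \<le> 0"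
proof (induction n)
  case (Suc n)
  then show ?case
    using assms(1) by (simp add: tent_map_piecewise mult_nonneg_nonpos)
qed (use assms in simp)

text \<open>The kink goes to \<open>H/2 \<ge> 1\<close>, then to \<open>H (1 - H/2) \<le> 0\<close>, and stays nonpositive.
  Going round the cycle twice, hence the exponent \<open>\<tau> * 2\<close>, makes at least these two steps even
  when \<open>\<tau> = 1\<close>.\<close>

lemma tent_map_kink_not_in_cycle:
  assumes "H \<ge> 2" "is_cycle (tent_map H) \<tau> C"
  shows "1/2 \<notin> C"
proof
  assume "1/2 \<in> C"
  have fixed: "(tent_map H ^^ (\<tau> * 2)) (1/2) = 1/2"
    using funpow_mult_periodic[OF is_cycle_periodic[OF assms(2) \<open>1/2 \<in> C\<close>]] .
  have "\<tau> > 0"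
    using assms(2) by (simp add: is_cycle_def)
  then have "\<tau> * 2 = (\<tau> * 2 - 2) + 2"
    by simp
  then have "(tent_map H ^^ (\<tau> * 2)) (1/2) = (tent_map H ^^ (\<tau> * 2 - 2)) ((tent_map H ^^ 2) (1/2))"
    by (metis comp_apply funpow_add)
  moreover have "(tent_map H ^^ 2) (1/2) \<le> 0"
    using assms(1) by (simp add: numeral_2_eq_2 tent_map_piecewise mult_nonneg_nonpos)
  ultimately have "(tent_map H ^^ (\<tau> * 2)) (1/2) \<le> 0"
    using tent_map_funpow_nonpos[of H] assms(1) by simp
  then show False
    using fixed by simp
qed

lemma tent_map_cycle_deriv:
  assumes "H \<ge> 2" "is_cycle (tent_map H) \<tau> C" "x \<in> C"
  shows "tent_map H differentiable at x" "\<bar>deriv (tent_map H) x\<bar> = H"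
proof -
  have "x \<noteq> 1/2"
    using tent_map_kink_not_in_cycle[OF assms(1,2)] assms(3) by blast
  note d = DERIV_tent_map[OF this, of H]
  show "tent_map H differentiable at x"
    using d by (auto simp: real_differentiable_def)
  show "\<bar>deriv (tent_map H) x\<bar> = H"
    using DERIV_imp_deriv[OF d] assms(1) by simp
qed

lemma tent_map_cycle_abs_multiplier:
  assumes "H \<ge> 2" "is_cycle (tent_map H) \<tau> C"
  shows "\<bar>multiplier (tent_map H) C\<bar> = H ^ \<tau>"
  using tent_map_cycle_deriv(2)[OF assms] is_cycle_card[OF assms(2)]
  by (simp add: multiplier_def abs_prod)

section \<open>The controlled map on a cycle of the tent map\<close>

lemma controlled_map_fixed: "(f ^^ T) x = x \<Longrightarrow> controlled_map f T \<theta> x = f x"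
  by (simp add: controlled_map_def algebra_simps)

lemma DERIV_controlled_map:
  assumes "(f ^^ T) x = x" "(f has_real_derivative d) (at x)" "(f ^^ T has_real_derivative M) (at x)"
  shows "(controlled_map f T \<theta> has_real_derivative d * (\<theta> + (1 - \<theta>) * M)) (at x)"
proof -
  have "((\<lambda>y. \<theta> * y + (1 - \<theta>) * (f ^^ T) y) has_real_derivative \<theta> + (1 - \<theta>) * M) (at x)"
    using assms(3) by (auto intro!: derivative_eq_intros)
  moreover have "\<theta> * x + (1 - \<theta>) * (f ^^ T) x = x"
    using assms(1) by (simp add: algebra_simps)
  ultimately show ?thesis
    using DERIV_chain2[of f d "\<lambda>y. \<theta> * y + (1 - \<theta>) * (f ^^ T) y" x] assms(2)
    unfolding controlled_map_def by simp
qed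

text \<open>\<open>\<mu>\<^sup>k\<close>, with \<open>\<mu>\<close> the multiplier, is the slope of the T-th iterate of the tent map at every
  point of the cycle, so the hypothesis bounds the slope of the controlled map there.\<close>

lemma las_cycle_of_slope:
  assumes "H \<ge> 2" "is_cycle (tent_map H) \<tau> C" "T = \<tau> * k"
    and slope: "H * \<bar>\<theta> + (1 - \<theta>) * multiplier (tent_map H) C ^ k\<bar> < 1"
  shows "las_cycle (controlled_map (tent_map H) T \<theta>) \<tau> C"
proof -
  let ?f = "tent_map H" and ?F = "controlled_map (tent_map H) T \<theta>"
  define M where "M = multiplier ?f C ^ k"
  have fixed: "(?f ^^ T) x = x" if "x \<in> C" for x
    unfolding assms(3) using is_cycle_periodic[OF assms(2) that] by (rule funpow_mult_periodic)
  have F_eq: "?F x = ?f x" if "x \<in> C" for x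
    using controlled_map_fixed[OF fixed[OF that]] .
  have DF: "(?F has_real_derivative deriv ?f x * (\<theta> + (1 - \<theta>) * M)) (at x)" if x: "x \<in> C" for x
  proof (rule DERIV_controlled_map[OF fixed[OF x]])
    show "(?f has_real_derivative deriv ?f x) (at x)"
      using tent_map_cycle_deriv(1)[OF assms(1,2) x]
      by (simp add: DERIV_deriv_iff_real_differentiable)
    have "M = (\<Prod>i<T. deriv ?f ((?f ^^ i) x))"
      unfolding M_def assms(3) multiplier_eq_prod_orbit[OF assms(2) x]
      using prod_periodic_orbit_mult[OF is_cycle_periodic[OF assms(2) x], of "deriv ?f" k] by simp
    then show "(?f ^^ T has_real_derivative M) (at x)"
      using DERIV_funpow[of T ?f x]
        tent_map_cycle_deriv(1)[OF assms(1,2) is_cycle_funpow_mem[OF assms(2) x]]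
      by simp
  qed
  have small: "\<bar>deriv ?f x * (\<theta> + (1 - \<theta>) * M)\<bar> < 1" if "x \<in> C" for x
    using slope tent_map_cycle_deriv(2)[OF assms(1,2) that] by (simp add: abs_mult M_def)
  have "is_cycle ?F \<tau> C"
    using is_cycle_cong[OF assms(2) F_eq] .
  note stable_attracting_of_deriv[OF is_cycle_finite is_cycle_nonempty is_cycle_image_subset DF small,
      OF this this this]
  with \<open>is_cycle ?F \<tau> C\<close> show ?thesis
    unfolding las_cycle_def by simp
qed

text \<open>The interval in each of the next two lemmas is centred at the zero of
  \<open>\<theta> + (1 - \<theta>) M\<close>, for \<open>M = A\<close> and \<open>M = - A\<close> respectively.\<close>

lemma slope_bound_pos:
  fixes A H \<theta> :: real
  assumes "H > 0" "A > 1" "(A - 1 / H) / (A - 1) < \<theta>" "\<theta> < (A + 1 / H) / (A - 1)"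
  shows "H * \<bar>\<theta> + (1 - \<theta>) * A\<bar> < 1"
proof -
  have "A - 1 / H < \<theta> * (A - 1)" "\<theta> * (A - 1) < A + 1 / H"
    using assms by (simp_all add: pos_divide_less_eq pos_less_divide_eq)
  then have "\<bar>\<theta> + (1 - \<theta>) * A\<bar> < 1 / H"
    by (simp add: abs_less_iff algebra_simps)
  then show ?thesis
    using assms(1) by (simp add: pos_less_divide_eq mult.commute)
qed

lemma slope_bound_neg:
  fixes A H \<theta> :: real
  assumes "H > 0" "A > 0" "(A - 1 / H) / (A + 1) < \<theta>" "\<theta> < (A + 1 / H) / (A + 1)"
  shows "H * \<bar>\<theta> + (1 - \<theta>) * (- A)\<bar> < 1"
proof -
  have "A - 1 / H < \<theta> * (A + 1)" "\<theta> * (A + 1) < A + 1 / H"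
    using assms by (simp_all add: pos_divide_less_eq pos_less_divide_eq)
  then have "\<bar>\<theta> + (1 - \<theta>) * (- A)\<bar> < 1 / H"
    by (simp add: abs_less_iff algebra_simps)
  then show ?thesis
    using assms(1) by (simp add: pos_less_divide_eq mult.commute)
qed

theorem theorem3:
  fixes H \<theta> :: real and T \<tau> :: nat
  assumes "H \<ge> 2" and "T \<ge> 1" and "\<tau> > 0" and "\<tau> dvd T"
  shows "((H ^ T - 1 / H) / (H ^ T - 1) < \<theta> \<and> \<theta> < (H ^ T + 1 / H) / (H ^ T - 1) \<longrightarrow>
            (\<forall>C. is_cycle (tent_map H) \<tau> C \<and> multiplier (tent_map H) C > 0 \<longrightarrow>
                 las_cycle (controlled_map (tent_map H) T \<theta>) \<tau> C) \<and>
            (even (T div \<tau>) \<longrightarrow>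
              (\<forall>C. is_cycle (tent_map H) \<tau> C \<and> multiplier (tent_map H) C < 0 \<longrightarrow>
                   las_cycle (controlled_map (tent_map H) T \<theta>) \<tau> C))) \<and>
         ((H ^ T - 1 / H) / (H ^ T + 1) < \<theta> \<and> \<theta> < (H ^ T + 1 / H) / (H ^ T + 1) \<longrightarrow>
            odd (T div \<tau>) \<longrightarrow>
              (\<forall>C. is_cycle (tent_map H) \<tau> C \<and> multiplier (tent_map H) C < 0 \<longrightarrow>
                   las_cycle (controlled_map (tent_map H) T \<theta>) \<tau> C))"
proof -
  let ?f = "tent_map H"
  define k where "k = T div \<tau>"
  have T: "T = \<tau> * k"
    using assms(4) by (simp add: k_def)
  have A: "H ^ T > 1"
    using assms(1,2) by (intro one_less_power) auto
  have pow_pos: "multiplier ?f C ^ k = H ^ T"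
    if "is_cycle ?f \<tau> C" "multiplier ?f C > 0 \<or> even k" for C
  proof -
    have "multiplier ?f C ^ k = \<bar>multiplier ?f C\<bar> ^ k"
      using that(2) by (auto simp: power_even_abs)
    then show ?thesis
      using tent_map_cycle_abs_multiplier[OF assms(1) that(1)] by (simp add: T power_mult)
  qed
  have pow_neg: "multiplier ?f C ^ k = - (H ^ T)"
    if "is_cycle ?f \<tau> C" "multiplier ?f C < 0" "odd k" for C
  proof -
    have "multiplier ?f C = - (H ^ \<tau>)"
      using tent_map_cycle_abs_multiplier[OF assms(1) that(1)] that(2) by simp
    then show ?thesis
      using that(3) by (simp add: T power_mult)
  qed
  show ?thesis
    unfolding k_def[symmetric]
  proof (intro conjI impI allI)
    fix C
    assume "(H ^ T - 1 / H) / (H ^ T - 1) < \<theta> \<and> \<theta> < (H ^ T + 1 / H) / (H ^ T - 1)"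
    then have bound: "H * \<bar>\<theta> + (1 - \<theta>) * H ^ T\<bar> < 1"
      using slope_bound_pos[of H "H ^ T" \<theta>] assms(1) A by simp
    {
      assume "is_cycle ?f \<tau> C \<and> multiplier ?f C > 0"
      then show "las_cycle (controlled_map ?f T \<theta>) \<tau> C"
        using las_cycle_of_slope[OF assms(1) _ T] pow_pos bound by simp
    next
      assume "even k" "is_cycle ?f \<tau> C \<and> multiplier ?f C < 0"
      then show "las_cycle (controlled_map ?f T \<theta>) \<tau> C"
        using las_cycle_of_slope[OF assms(1) _ T] pow_pos bound by simp
    }
  next
    fix C
    assume "(H ^ T - 1 / H) / (H ^ T + 1) < \<theta> \<and> \<theta> < (H ^ T + 1 / H) / (H ^ T + 1)"
      and C: "odd k" "is_cycle ?f \<tau> C \<and> multiplier ?f C < 0"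
    then have "H * \<bar>\<theta> + (1 - \<theta>) * (- (H ^ T))\<bar> < 1"
      using slope_bound_neg[of H "H ^ T" \<theta>] assms(1) A by simp
    then show "las_cycle (controlled_map ?f T \<theta>) \<tau> C"
      using las_cycle_of_slope[OF assms(1) _ T] pow_neg C by simp
  qed
qed

end
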